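(* Let $d\ge3$ and $m\in\{2,3,4\}$, and let $H_m\subset\mathbb{R}^d$ be the intersection of two half-spaces with angle $\pi/m$ between their supporting hyperplanes, $H_m=\{x\in\mathbb{R}^d\colon\langle x,v_{1,m}\rangle>0,\ \langle x,v_{2,m}\rangle>0\}$ with $v_{1,m},v_{2,m}$ as specified in the context. Then, uniformly in $x,y\in H_m$ and $t>0$, the Dirichlet heat kernel $p_t^{H_m}$ of $H_m$ satisfies $$ p_t^{H_m}(x,y)\simeq\Big(1\wedge\frac{\delta_{E}(x)\delta_{E}(y)}{t}\Big)^{m-2}\Big(1\wedge\frac{\delta_{S_{1,m}}(x)\delta_{S_{1,m}}(y)}{t}\Big)\Big(1\wedge\frac{\delta_{S_{2,m}}(x)\delta_{S_{2,m}}(y)}{t}\Big)\,p_t^{(d)}(x-y). $$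
   Context: $p_t^{(n)}(w)=(4\pi t)^{-n/2}\exp(-\|w\|^2/4t)$, $w\in\mathbb{R}^n$, is the $n$-dimensional Gauss-Weierstrass kernel; $a\wedge b=\min(a,b)$. The unit vectors $v_{1,m},v_{2,m}\in\mathbb{R}^d$ are: for $m$ even, $v_{1,m}=(0,\dots,0,0,1)$ and $v_{2,m}=(0,\dots,0,\sin(\pi/m),-\cos(\pi/m))$; for $m$ odd, $v_{1,m}=(0,\dots,0,\sin(\pi/2m),\cos(\pi/2m))$ and $v_{2,m}=(0,\dots,0,\sin(\pi/2m),-\cos(\pi/2m))$. Thus $H_m=\mathbb{R}^{d-2}\times C_+^{(m)}$, where $C_+^{(m)}\subset\mathbb{R}^2\simeq\mathbb{C}$ is the cone $\{\rho e^{i\theta}\colon\rho>0,\ 0<\theta<\pi/m\}$ for $m$ even and $\{\rho e^{i\theta}\colon\rho>0,\ |\theta|<\pi/2m\}$ for $m$ odd. For $k=1,2$, $S_{k,m}=\overline{H_m}\cap\{x\in\mathbb{R}^d\colon\langle x,v_{k,m}\rangle=0\}$ are the two flat parts of the boundary of $H_m$, and $E_m=S_{1,m}\cap S_{2,m}$ is the edge. For $x\in H_m$, $\delta_{S_{k,m}}(x)$ and $\delta_{E}(x)$ are the Euclidean distances of $x$ to $S_{k,m}$ and to $E_m$, respectively. The Dirichlet heat kernel of $H_m$ is given, for $x=(x',x'')$, $y=(y',y'')$ in $H_m\subset\mathbb{R}^{d-2}\times\mathbb{R}^2$ and $t>0$, by $p_t^{H_m}(x,y)=p_t^{(d-2)}(x'-y')\,p_t^{\det,C_+^{(m)}}(x'',y'')$,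 where $p_t^{\det,C_+^{(m)}}$ is the Dirichlet heat kernel of $C_+^{(m)}$, $p_t^{\det,C_+^{(m)}}(u,v)=\sum_{g\in W_m}\det(g)\,p_t^{(2)}(gu-v)$, $u,v\in C_+^{(m)}$, and $W_m\subset O(2)$ is the dihedral group of order $2m$ generated by the orthogonal reflections in the lines perpendicular to the vectors $e^{i\pi j/m}$, $j=0,\dots,2m-1$. $X\simeq Y$ uniformly in the indicated variables means that there is a constant $C>0$, independent of $x,y,t$, with $C^{-1}Y\le X\le CY$. *)

theory Defs
  imports "HOL-Analysis.Analysis" "HOL-Algebra.Generated_Groups"
begin

text \<open>
  \<open>\<real>\<^sup>d\<close> with \<open>d \<ge> 3\<close> is represented, following the splitting
  \<open>x = (x', x'')\<close>, by the Euclidean space \<open>(real ^ 'n) \<times> (real ^ 2)\<close> with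
  \<open>CARD('n) = d - 2 \<ge> 1\<close>; its inner product and norm are the standard ones.
\<close>

definition gauss_weierstrass :: "real \<Rightarrow> 'a::euclidean_space \<Rightarrow> real" where
  "gauss_weierstrass t w =
     (4 * pi * t) powr (- (real DIM('a) / 2)) * exp (- (norm w)\<^sup>2 / (4 * t))"

definition wedge_normal1 :: "nat \<Rightarrow> (real ^ 'n) \<times> (real ^ 2)" where
  "wedge_normal1 m =
     (if even m then (0, vector [0, 1])
      else (0, vector [sin (pi / (2 * real m)), cos (pi / (2 * real m))]))"

definition wedge_normal2 :: "nat \<Rightarrow> (real ^ 'n) \<times> (real ^ 2)" where
  "wedge_normal2 m =
     (if even m then (0, vector [sin (pi / real m), - cos (pi / real m)])
      else (0, vector [sin (pi / (2 * real m)), - cos (pi / (2 * real m))]))"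

definition wedge :: "nat \<Rightarrow> ((real ^ 'n) \<times> (real ^ 2)) set" where
  "wedge m = {x. x \<bullet> wedge_normal1 m > 0 \<and> x \<bullet> wedge_normal2 m > 0}"

definition wedge_side1 :: "nat \<Rightarrow> ((real ^ 'n) \<times> (real ^ 2)) set" where
  "wedge_side1 m = closure (wedge m) \<inter> {x. x \<bullet> wedge_normal1 m = 0}"

definition wedge_side2 :: "nat \<Rightarrow> ((real ^ 'n) \<times> (real ^ 2)) set" where
  "wedge_side2 m = closure (wedge m) \<inter> {x. x \<bullet> wedge_normal2 m = 0}"

definition wedge_edge :: "nat \<Rightarrow> ((real ^ 'n) \<times> (real ^ 2)) set" where
  "wedge_edge m = wedge_side1 m \<inter> wedge_side2 m"

definition reflection_matrix :: "real ^ 'n \<Rightarrow> real ^ 'n ^ 'n" where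
  "reflection_matrix a = matrix (\<lambda>x. x - (2 * (x \<bullet> a) / (a \<bullet> a)) *\<^sub>R a)"

definition orthogonal_group2 :: "(real ^ 2 ^ 2) monoid" where
  "orthogonal_group2 =
     \<lparr>carrier = {A. orthogonal_matrix A}, monoid.mult = (**), one = mat 1\<rparr>"

definition dihedral_reflection_group :: "nat \<Rightarrow> (real ^ 2 ^ 2) set" where
  "dihedral_reflection_group m =
     generate orthogonal_group2
       ((\<lambda>j. reflection_matrix (vector [cos (pi * real j / real m), sin (pi * real j / real m)]))
          ` {0..2 * m - 1})"

definition cone_heat_kernel :: "nat \<Rightarrow> real \<Rightarrow> real ^ 2 \<Rightarrow> real ^ 2 \<Rightarrow> real" where
  "cone_heat_kernel m t u v =
     (\<Sum>g\<in>dihedral_reflection_group m. det g * gauss_weierstrass t (g *v u - v))"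

text \<open>The formula is meaningful as a Dirichlet heat kernel only for \<open>x, y \<in> wedge m\<close>.\<close>

definition wedge_heat_kernel ::
    "nat \<Rightarrow> real \<Rightarrow> (real ^ 'n) \<times> (real ^ 2) \<Rightarrow> (real ^ 'n) \<times> (real ^ 2) \<Rightarrow> real" where
  "wedge_heat_kernel m t x y =
     gauss_weierstrass t (fst x - fst y) * cone_heat_kernel m t (snd x) (snd y)"

definition uniformly_comparable_on :: "'a set \<Rightarrow> ('a \<Rightarrow> real) \<Rightarrow> ('a \<Rightarrow> real) \<Rightarrow> bool" where
  "uniformly_comparable_on A X Y \<longleftrightarrow>
     (\<exists>C>0. \<forall>z\<in>A. inverse C * Y z \<le> X z \<and> X z \<le> C * Y z)"

end

theory Submission
  imports Defs
begin

text \<open>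
  Every \<open>g\<close> in the dihedral group is an isometry, so dividing the reflection formula for the
  heat kernel by the free Gaussian kernel leaves the alternating sum
  \<open>f = (\<Sum>g. det g * exp (- (u \<bullet> v - g u \<bullet> v) / (2 * t)))\<close>, where \<open>u\<close>, \<open>v\<close> are the planar
  components of the two points; the factor of the directions along the edge cancels. The task is
  to show that \<open>f\<close> is comparable to the product of the three boundary factors. In the
  wedge the distances to the two sides are the inner products with the two normals (the angle is
  at most a right angle), and the distance to the edge is the norm of the planar component, which is
  comparable to its first coordinate when \<open>m \<ge> 3\<close>.

  With \<open>s x = 1 - exp (- x)\<close>, which is comparable to \<open>min 1 x\<close>, the sum takes the following
  forms.

  For \<open>m = 2\<close> it is \<open>s A * s B\<close>, one factor for each side.

  For \<open>m = 3\<close> let \<open>a1, a2\<close> and \<open>b1, b2\<close> be the distances of the two points to the sides, and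
  let \<open>A, B, P, Q\<close> be \<open>a1 * b1\<close>, \<open>a2 * b2\<close>, \<open>a1 * b2\<close>, \<open>a2 * b1\<close>, each divided by \<open>t\<close>. Then
  \<open>f = s A * s B - exp (- A - B) * (s P * s Q)\<close>. The relation \<open>P * Q = A * B\<close> makes
  the two products agree to leading order, and rational bounds for the exponential show that
  \<open>f / (s A * s B)\<close> is comparable to \<open>min 1 (A + B + P + Q)\<close>, which is the edge factor.

  For \<open>m = 4\<close> let \<open>A, B, P, Q\<close> be the products \<open>u1 * v1\<close>, \<open>u2 * v2\<close>, \<open>u1 * v2\<close>, \<open>u2 * v1\<close> of
  coordinates, divided by \<open>2 * t\<close>. The sum is a determinant of hyperbolic sines,
  \<open>4 * exp (- A - B) * (sinh A * sinh B - sinh P * sinh Q)\<close>, again with \<open>A * B = P * Q\<close>, so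
  \<open>f = s (2 * A) * s (2 * B) * (1 - exp (- \<Delta>))\<close> where \<open>\<Delta>\<close> is the variation of
  \<open>ln (sinh x) + ln (sinh (N / x))\<close> between \<open>Q\<close> and \<open>A\<close>, for \<open>N = A * B\<close>. Its derivative is
  \<open>(k x - k (N / x)) / x\<close> with \<open>k x = x * cosh x / sinh x\<close>, and \<open>k'\<close> is
  comparable to \<open>min 1 x\<close>; since \<open>R = A + B - P - Q\<close> is the variation of \<open>x + N / x\<close> between
  the same points, \<open>\<Delta>\<close> is comparable to \<open>min 1 A * R\<close>. Here \<open>R\<close> belongs to the second side and
  \<open>A\<close> supplies the second power of the edge factor.

  The bounds are \<open>A2_alternating_sum_bounds\<close> and \<open>B2_alternating_sum_bounds\<close>, named after
  the root systems of the two reflection groups; \<open>wedge_heat_kernel_eq\<close> carries out the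
  reduction to the alternating sum.
\<close>

section \<open>Bounds for one minus an exponential\<close>

lemma nonneg_if_deriv_nonneg:
  fixes f f' :: "real \<Rightarrow> real"
  assumes "\<And>x. DERIV f x :> f' x" and "\<And>x. x \<ge> 0 \<Longrightarrow> f' x \<ge> 0"
    and "x \<ge> 0" and "f 0 = 0"
  shows "f x \<ge> 0"
  using DERIV_nonneg_imp_nondecreasing[of 0 x f] assms by metis

lemma one_minus_exp_le_min: "x \<ge> 0 \<Longrightarrow> 1 - exp (- x) \<le> min 1 (x::real)"
  using exp_ge_add_one_self[of "-x"] by simp

lemma one_minus_exp_ge_min:
  assumes "(x::real) \<ge> 0" shows "min 1 x / 2 \<le> 1 - exp (- x)"
proof -
  have "exp (-x) \<le> 1 / (1 + x)"
    using exp_ge_add_one_self[of x] assms by (simp add: exp_minus field_simps)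
  moreover have "min 1 x / 2 \<le> 1 - 1 / (1 + x)"
  proof (cases "x \<le> 1")
    case True
    have "x * x \<le> x" using True assms by (simp add: mult_left_le)
    with True show ?thesis using assms by (simp add: field_simps)
  qed (use assms in \<open>simp add: field_simps\<close>)
  ultimately show ?thesis by linarith
qed

text \<open>
  Equivalent to \<open>tanh (x / 2) \<le> x / 2\<close>. This form gains a factor \<open>1 + x / 2\<close> over the bound by \<open>x\<close>,
  and that gain is what separates the two products in the case \<open>m = 3\<close>.
\<close>

lemma one_minus_exp_le_rational:
  assumes "(x::real) \<ge> 0" shows "(1 - exp (- x)) * (1 + x / 2) \<le> x"
proof -
  define q where "q = (\<lambda>x::real. x / 2 - 1 + (1 + x / 2) * exp (- x))"
  have "DERIV q y :> (1 - (1 + y) * exp (- y)) / 2" for y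
    unfolding q_def by (auto intro!: derivative_eq_intros simp: field_simps)
  moreover have "(1 - (1 + y) * exp (- y)) / 2 \<ge> 0" for y :: real
  proof -
    have "(1 + y) * exp (- y) \<le> exp y * exp (- y)"
      by (intro mult_right_mono exp_ge_add_one_self) auto
    thus ?thesis by (simp flip: exp_add)
  qed
  ultimately have "q x \<ge> 0"
    using assms by (rule nonneg_if_deriv_nonneg) (simp add: q_def)
  thus ?thesis by (simp add: q_def field_simps)
qed

lemma one_minus_exp_ge_quadratic:
  assumes "(x::real) \<ge> 0" shows "x * exp (- x) * (1 + x / 2) \<le> 1 - exp (- x)"
proof -
  have "(x + x\<^sup>2 / 2) * exp (- x) \<le> (exp x - 1) * exp (- x)"
    using exp_lower_Taylor_quadratic[OF assms] by (intro mult_right_mono) auto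
  also have "\<dots> = 1 - exp (- x)" by (simp add: algebra_simps flip: exp_add)
  finally show ?thesis by (simp add: algebra_simps power2_eq_square)
qed

section \<open>The alternating sum for the angle pi/3\<close>

text \<open>
  For the lower bound, \<open>s x = 1 - exp (- x)\<close> satisfies \<open>x * exp (- x) * (1 + x / 2) \<le> s x\<close> and
  \<open>s x * (1 + x / 2) \<le> x\<close>. The first is used at \<open>A\<close>, \<open>B\<close> and the second at \<open>P\<close>, \<open>Q\<close>; through
  \<open>P * Q = A * B\<close> they combine to show that the subtracted term is at most \<open>s A * s B\<close>
  divided by the product of all four factors \<open>1 + x / 2\<close>, hence divided by \<open>1 + S / 2\<close>. For the
  upper bound the subtracted term is at least \<open>exp (- S) * (P * Q) \<ge> (1 - S) * (s A * s B)\<close>.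
\<close>

lemma A2_alternating_sum_bounds:
  fixes A B P Q :: real
  assumes pos: "A > 0" "B > 0" "P > 0" "Q > 0" and PQ: "P * Q = A * B"
  defines "S \<equiv> A + B + P + Q"
  defines "f \<equiv> (1 - exp (-A)) * (1 - exp (-B)) - exp (- A - B) * ((1 - exp (-P)) * (1 - exp (-Q)))"
  shows "(1 - exp (-A)) * (1 - exp (-B)) * (min 1 S / 3) \<le> f"
    and "f \<le> (1 - exp (-A)) * (1 - exp (-B)) * min 1 S"
proof -
  define a b where "a = 1 - exp (-A)" and "b = 1 - exp (-B)"
  define g where "g = exp (- A - B) * ((1 - exp (-P)) * (1 - exp (-Q)))"
  have ab: "a > 0" "b > 0" using pos by (auto simp: a_def b_def)
  have S: "S > 0" using pos by (simp add: S_def)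
  have g0: "g \<ge> 0" using pos by (simp add: g_def)
  have "g * ((1 + P/2) * (1 + Q/2)) =
      exp (- A - B) * (((1 - exp (-P)) * (1 + P/2)) * ((1 - exp (-Q)) * (1 + Q/2)))"
    by (simp add: g_def)
  also have "\<dots> \<le> exp (- A - B) * (P * Q)"
    using pos by (intro mult_left_mono mult_mono one_minus_exp_le_rational) auto
  finally have 1: "g * ((1 + P/2) * (1 + Q/2)) \<le> exp (- A - B) * (A * B)" by (simp add: PQ)
  have 2: "exp (- A - B) * (A * B) * ((1 + A/2) * (1 + B/2)) \<le> a * b"
  proof -
    have "(A * exp (- A) * (1 + A / 2)) * (B * exp (- B) * (1 + B / 2)) \<le> a * b"
      unfolding a_def b_def using pos by (intro mult_mono one_minus_exp_ge_quadratic) auto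
    thus ?thesis by (simp add: mult_ac exp_diff exp_minus field_simps)
  qed
  have "g * (1 + S/2) \<le> g * (((1 + P/2) * (1 + Q/2)) * ((1 + A/2) * (1 + B/2)))"
  proof (intro mult_left_mono g0)
    have "1 + (P+Q)/2 \<le> (1 + P/2) * (1 + Q/2)" "1 + (A+B)/2 \<le> (1 + A/2) * (1 + B/2)"
      using pos by (simp_all add: algebra_simps)
    hence "(1 + (P+Q)/2) * (1 + (A+B)/2) \<le> ((1 + P/2) * (1 + Q/2)) * ((1 + A/2) * (1 + B/2))"
      using pos by (intro mult_mono) auto
    moreover have "1 + S/2 + (P+Q) * (A+B) / 4 = (1 + (P+Q)/2) * (1 + (A+B)/2)"
      by (simp add: S_def field_simps)
    moreover have "0 \<le> (P+Q) * (A+B) / 4" using pos by simp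
    ultimately show "1 + S/2 \<le> ((1 + P/2) * (1 + Q/2)) * ((1 + A/2) * (1 + B/2))" by linarith
  qed
  also have "\<dots> = (g * ((1 + P/2) * (1 + Q/2))) * ((1 + A/2) * (1 + B/2))" by simp
  also have "\<dots> \<le> (exp (- A - B) * (A * B)) * ((1 + A/2) * (1 + B/2))"
    using pos by (intro mult_right_mono 1) auto
  also note 2
  finally have 3: "g \<le> a * b / (1 + S/2)" using S by (simp add: field_simps)
  have "a * b * (min 1 S / 3) \<le> a * b * (S / (2 + S))"
  proof (intro mult_left_mono)
    show "min 1 S / 3 \<le> S / (2 + S)"
    proof (cases "S \<le> 1")
      case True
      hence "S * S \<le> S" using S by (simp add: mult_left_le)
      with True S show ?thesis by (simp add: field_simps)
    qed (use S in \<open>simp add: field_simps\<close>)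
  qed (use ab in auto)
  also have "\<dots> = a * b - a * b / (1 + S/2)" using S by (simp add: field_simps)
  also have "\<dots> \<le> a * b - g" using 3 by simp
  finally show "(1 - exp (-A)) * (1 - exp (-B)) * (min 1 S / 3) \<le> f"
    by (simp add: a_def b_def f_def g_def)
  have "a * b * (1 - S) \<le> (A * B) * exp (- S)"
  proof (cases "S \<le> 1")
    case True
    thus ?thesis unfolding a_def b_def using pos exp_ge_add_one_self[of "-S"]
      one_minus_exp_le_min[of A] one_minus_exp_le_min[of B] by (intro mult_mono) auto
  next
    case False
    hence "a * b * (1 - S) \<le> 0" using ab by (intro mult_nonneg_nonpos) auto
    also have "0 \<le> (A * B) * exp (- S)" using pos by simp
    finally show ?thesis .
  qed
  also have "\<dots> = exp (- A - B) * ((P * exp (- P)) * (Q * exp (- Q)))"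
    unfolding PQ[symmetric] S_def by (simp add: exp_diff exp_minus exp_add field_simps)
  also have "\<dots> \<le> g" unfolding g_def
  proof (intro mult_left_mono mult_mono)
    have *: "x * exp (- x) \<le> 1 - exp (- x)" if "x > 0" for x :: real
    proof -
      have "x * exp (- x) * 1 \<le> x * exp (- x) * (1 + x / 2)"
        using that by (intro mult_left_mono) auto
      thus ?thesis using one_minus_exp_ge_quadratic[of x] that by linarith
    qed
    show "P * exp (- P) \<le> 1 - exp (- P)" "Q * exp (- Q) \<le> 1 - exp (- Q)"
      using * pos by auto
  qed (use pos in auto)
  finally have "a * b - g \<le> a * b * S" by (simp add: algebra_simps)
  moreover have "a * b - g \<le> a * b" using g0 by simp
  ultimately show "f \<le> (1 - exp (-A)) * (1 - exp (-B)) * min 1 S"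
    by (auto simp add: min_def a_def b_def f_def g_def)
qed

section \<open>The alternating sum for the angle pi/4\<close>

text \<open>
  A lower bound for the derivative of \<open>x * coth x\<close>, which at \<open>x = y / 2\<close> is
  \<open>(sinh y - y) / (cosh y - 1)\<close>. The factor \<open>3 + y\<close> matches the ratio \<open>y / 3\<close> near zero and keeps
  the third derivative of the difference of the two sides visibly nonnegative.
\<close>

lemma sinh_minus_self_lower_bound:
  fixes y :: real assumes "y \<ge> 0"
  shows "y * (cosh y - 1) \<le> (3 + y) * (sinh y - y)"
proof -
  define G0 where "G0 = (\<lambda>y::real. 3 * sinh y - 2 * y - y\<^sup>2 - y * exp (- y))"
  define G1 where "G1 = (\<lambda>y::real. 3 * cosh y - 2 - 2 * y - exp (- y) + y * exp (- y))"
  define G2 where "G2 = (\<lambda>y::real. 3 * sinh y - 2 + 2 * exp (- y) - y * exp (- y))"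
  define G3 where "G3 = (\<lambda>y::real. 3 * cosh y - 3 * exp (- y) + y * exp (- y))"
  have d0: "DERIV G0 x :> G1 x" for x unfolding G0_def G1_def
    by (auto intro!: derivative_eq_intros simp: algebra_simps)
  have d1: "DERIV G1 x :> G2 x" for x unfolding G1_def G2_def
    by (auto intro!: derivative_eq_intros simp: algebra_simps)
  have d2: "DERIV G2 x :> G3 x" for x unfolding G2_def G3_def
    by (auto intro!: derivative_eq_intros simp: algebra_simps)
  have "G3 x \<ge> 0" if "x \<ge> 0" for x
  proof -
    have "exp (- x) \<le> cosh x" using that by (simp add: cosh_def)
    moreover have "x * exp (- x) \<ge> 0" using that by simp
    ultimately show ?thesis unfolding G3_def by linarith
  qed
  with d2 have "G2 x \<ge> 0" if "x \<ge> 0" for x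
    using that by (rule nonneg_if_deriv_nonneg) (simp_all add: G2_def)
  with d1 have "G1 x \<ge> 0" if "x \<ge> 0" for x
    using that by (rule nonneg_if_deriv_nonneg) (simp_all add: G1_def)
  with d0 have "G0 y \<ge> 0"
    using assms by (rule nonneg_if_deriv_nonneg) (simp_all add: G0_def)
  moreover have "y * (cosh y - sinh y) = y * exp (- y)"
    by (simp add: cosh_minus_sinh)
  ultimately show ?thesis by (simp add: G0_def algebra_simps power2_eq_square)
qed

definition xcoth :: "real \<Rightarrow> real" where "xcoth x = x * cosh x / sinh x"

definition xcoth' :: "real \<Rightarrow> real" where
  "xcoth' x = (sinh x * cosh x - x) / (sinh x)\<^sup>2"

lemma xcoth_deriv: "x > 0 \<Longrightarrow> DERIV xcoth x :> xcoth' x"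
proof -
  assume x: "x > 0"
  hence s: "sinh x \<noteq> 0" by simp
  have c: "cosh x * cosh x = 1 + sinh x * sinh x"
    using cosh_square_eq[of x] by (simp add: power2_eq_square)
  show ?thesis unfolding xcoth_def[abs_def] xcoth'_def using s
    by (auto intro!: derivative_eq_intros simp: field_simps power2_eq_square c)
qed

lemma xcoth'_le:
  assumes "x > 0" shows "xcoth' x \<le> min 1 x"
proof -
  have s: "sinh x > 0" using assms by simp
  have "sinh x * (cosh x - sinh x) \<le> x"
  proof -
    have "sinh x * (cosh x - sinh x) = (exp x * exp (- x) - exp (- x) * exp (- x)) / 2"
      unfolding cosh_minus_sinh by (simp add: sinh_field_def field_simps)
    hence "sinh x * (cosh x - sinh x) = (1 - exp (- (2 * x))) / 2"
      by (simp flip: exp_add)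
    thus ?thesis using one_minus_exp_le_min[of "2 * x"] assms by simp
  qed
  hence 1: "xcoth' x \<le> 1" using s by (simp add: xcoth'_def field_simps power2_eq_square)
  define g where "g = (\<lambda>y::real. y * cosh y - sinh y)"
  have "DERIV g y :> y * sinh y" for y
    unfolding g_def by (auto intro!: derivative_eq_intros)
  moreover have "y * sinh y \<ge> 0" if "y \<ge> 0" for y :: real using that by simp
  ultimately have "g x \<ge> 0"
    using less_imp_le[OF assms] by (rule nonneg_if_deriv_nonneg) (simp_all add: g_def)
  hence "sinh x \<le> x * cosh x" by (simp add: g_def)
  hence "sinh x * cosh x \<le> x * cosh x * cosh x" by (intro mult_right_mono) auto
  also have "\<dots> = x + x * (sinh x)\<^sup>2"
    using cosh_square_eq[of x] by (simp add: power2_eq_square algebra_simps)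
  finally have "xcoth' x \<le> x" using s by (simp add: xcoth'_def field_simps)
  with 1 show ?thesis by simp
qed

lemma xcoth'_ge:
  assumes "x > 0" shows "2 / 5 * min 1 x \<le> xcoth' x"
proof -
  have s: "sinh x > 0" using assms by simp
  have "cosh (2 * x) - 1 = 2 * (sinh x)\<^sup>2"
    using cosh_square_eq[of x] by (simp add: cosh_double)
  moreover have "sinh (2 * x) = 2 * sinh x * cosh x" by (rule sinh_double)
  ultimately have "2 * x * (sinh x)\<^sup>2 \<le> (3 + 2 * x) * (sinh x * cosh x - x)"
    using sinh_minus_self_lower_bound[of "2 * x"] assms by (simp add: algebra_simps)
  hence "2 * x / (3 + 2 * x) \<le> xcoth' x" using s assms by (simp add: xcoth'_def field_simps)
  moreover have "2 / 5 * min 1 x \<le> 2 * x / (3 + 2 * x)"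
  proof (cases "x \<le> 1")
    case True
    hence "x * x \<le> x" using assms by (simp add: mult_left_le)
    with True assms show ?thesis by (simp add: field_simps)
  qed (use assms in \<open>simp add: field_simps\<close>)
  ultimately show ?thesis by linarith
qed

lemma xcoth_diff_le:
  assumes "0 < w" "w \<le> x" shows "xcoth x - xcoth w \<le> min 1 x * (x - w)"
proof -
  let ?g = "\<lambda>y. min 1 x * y - xcoth y"
  have "?g w \<le> ?g x"
  proof (rule DERIV_nonneg_imp_nondecreasing[where f = ?g])
    fix y assume y: "w \<le> y" "y \<le> x"
    have "DERIV ?g y :> min 1 x - xcoth' y"
      using assms y by (intro DERIV_diff DERIV_cmult_Id xcoth_deriv) auto
    moreover have "min 1 y \<le> min 1 x" using y by (intro min.mono) auto
    hence "min 1 x - xcoth' y \<ge> 0" using xcoth'_le[of y] assms y by linarith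
    ultimately show "\<exists>z. DERIV ?g y :> z \<and> z \<ge> 0" by blast
  qed (use assms in auto)
  thus ?thesis by (simp add: algebra_simps)
qed

text \<open>
  Dropping the lower half of the interval costs a factor \<open>2\<close>, and on the upper half the derivative is
  bounded below by a multiple of its size at \<open>x\<close>. The same device, now with the convexity of
  \<open>x + N / x\<close>, gives the lower bound in \<open>ln_sinh_hyperbola_bounds\<close>.
\<close>

lemma xcoth_diff_ge:
  assumes "0 < w" "w \<le> x" shows "min 1 x * (x - w) / 10 \<le> xcoth x - xcoth w"
proof -
  define v where "v = (x + w) / 2"
  have v: "w \<le> v" "v \<le> x" "x / 2 \<le> v" "v > 0" using assms by (auto simp: v_def)
  have "xcoth w \<le> xcoth v"
  proof (rule DERIV_nonneg_imp_nondecreasing[OF v(1)])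
    fix y assume y: "w \<le> y" "y \<le> v"
    hence "0 \<le> 2 / 5 * min 1 y" using assms by simp
    hence "0 \<le> xcoth' y" using xcoth'_ge[of y] assms y by linarith
    moreover have "DERIV xcoth y :> xcoth' y" using assms y by (intro xcoth_deriv) auto
    ultimately show "\<exists>z. DERIV xcoth y :> z \<and> z \<ge> 0" by blast
  qed
  let ?g = "\<lambda>y. xcoth y - min 1 x / 5 * y"
  have "?g v \<le> ?g x"
  proof (rule DERIV_nonneg_imp_nondecreasing[where f = ?g, OF v(2)])
    fix y assume y: "v \<le> y" "y \<le> x"
    have "DERIV ?g y :> xcoth' y - min 1 x / 5"
      using v y by (intro DERIV_diff DERIV_cmult_Id xcoth_deriv) auto
    moreover have "min 1 x / 5 \<le> 2 / 5 * min 1 y" using v y by (auto simp: min_def)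
    hence "xcoth' y - min 1 x / 5 \<ge> 0" using xcoth'_ge[of y] v y by linarith
    ultimately show "\<exists>z. DERIV ?g y :> z \<and> z \<ge> 0" by blast
  qed
  hence "min 1 x / 5 * (x - v) \<le> xcoth x - xcoth v" by (simp add: right_diff_distrib)
  moreover have "min 1 x / 5 * (x - v) = min 1 x * (x - w) / 10" by (simp add: v_def field_simps)
  ultimately show ?thesis using \<open>xcoth w \<le> xcoth v\<close> by linarith
qed

text \<open>
  Along the hyperbola \<open>x * w = N\<close> both \<open>\<Delta>\<close> and \<open>R\<close> are variations between \<open>Q\<close> and \<open>A\<close>, of
  \<open>F x = ln (sinh x) + ln (sinh (N / x))\<close> and of \<open>r x = x + N / x\<close>. The quotient of their derivatives
  is the difference quotient of \<open>x * coth x\<close> between \<open>N / x\<close> and \<open>x\<close>, which is comparable to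
  \<open>min 1 x\<close>.
\<close>

lemma ln_sinh_hyperbola_bounds:
  fixes A B P Q :: real
  assumes pos: "0 < P" "P \<le> Q" "Q \<le> A" and AB: "A * B = P * Q"
  defines "R \<equiv> A + B - P - Q"
  defines "\<Delta> \<equiv> ln (sinh A) + ln (sinh B) - ln (sinh P) - ln (sinh Q)"
  shows "min 1 A * R / 40 \<le> \<Delta>" and "\<Delta> \<le> min 1 A * R"
proof -
  define N where "N = A * B"
  define F where "F = (\<lambda>x. ln (sinh x) + ln (sinh (N / x)))"
  define r where "r = (\<lambda>x. x + N / x)"
  define F' where "F' = (\<lambda>x. (xcoth x - xcoth (N / x)) / x)"
  have A: "A > 0" and Q: "Q > 0" using pos by auto
  have N: "N > 0" using AB pos by (simp add: N_def)
  have NA: "N / A = B" using A by (simp add: N_def)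
  have NQ: "N / Q = P" using Q by (simp add: N_def AB)
  have \<Delta>: "\<Delta> = F A - F Q" unfolding \<Delta>_def F_def NA NQ by simp
  have R: "R = r A - r Q" unfolding R_def r_def NA NQ by simp
  have dF: "DERIV F x :> F' x" if "x > 0" for x
  proof -
    have y: "N / x > 0" using that N by simp
    have 1: "DERIV (\<lambda>x. N / x) x :> - (N / x) / x"
      using that by (auto intro!: derivative_eq_intros)
    have 2: "DERIV (\<lambda>x. ln (sinh x)) y :> cosh y / sinh y" if "y > 0" for y :: real
      using that by (auto intro!: derivative_eq_intros simp: field_simps)
    have "DERIV F x :> cosh x / sinh x + cosh (N / x) / sinh (N / x) * (- (N / x) / x)"
      unfolding F_def by (intro DERIV_add 2 that DERIV_chain2[OF 2 1] y)
    moreover have "cosh x / sinh x + cosh (N / x) / sinh (N / x) * (- (N / x) / x) = F' x"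
      unfolding F'_def xcoth_def using that by (simp add: diff_divide_distrib mult_ac)
    ultimately show ?thesis by simp
  qed
  have dr: "DERIV r x :> 1 - N / x\<^sup>2" if "x > 0" for x
    unfolding r_def using that by (auto intro!: derivative_eq_intros simp: power2_eq_square)
  have Nx: "N / x > 0" "N / x \<le> x" "(x - N / x) / x = 1 - N / x\<^sup>2" "1 - N / x\<^sup>2 \<ge> 0" if "Q \<le> x" for x
  proof -
    have x: "x > 0" using that Q by simp
    show "N / x > 0" using x N by simp
    have "N \<le> Q * Q" using pos AB by (simp add: N_def)
    also have "\<dots> \<le> x * x" using that Q by (intro mult_mono) auto
    finally show "N / x \<le> x" "1 - N / x\<^sup>2 \<ge> 0" using x by (simp_all add: field_simps power2_eq_square)
    show "(x - N / x) / x = 1 - N / x\<^sup>2" using x by (simp add: field_simps power2_eq_square)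
  qed
  have F'_le: "F' x \<le> min 1 x * (1 - N / x\<^sup>2)" if "Q \<le> x" for x
  proof -
    have "F' x \<le> (min 1 x * (x - N / x)) / x" unfolding F'_def
      using Nx[OF that] that Q by (intro divide_right_mono xcoth_diff_le) auto
    also have "\<dots> = min 1 x * ((x - N / x) / x)" by (rule times_divide_eq_right[symmetric])
    finally show ?thesis unfolding Nx(3)[OF that] .
  qed
  have F'_ge: "min 1 x / 10 * (1 - N / x\<^sup>2) \<le> F' x" if "Q \<le> x" for x
  proof -
    have "min 1 x / 10 * ((x - N / x) / x) = (min 1 x * (x - N / x) / 10) / x" by simp
    also have "\<dots> \<le> F' x" unfolding F'_def
      using Nx[OF that] that Q by (intro divide_right_mono xcoth_diff_ge) auto
    finally show ?thesis unfolding Nx(3)[OF that] .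
  qed
  let ?g = "\<lambda>y. min 1 A * r y - F y"
  have "?g Q \<le> ?g A"
  proof (rule DERIV_nonneg_imp_nondecreasing[where f = ?g, OF pos(3)])
    fix y assume y: "Q \<le> y" "y \<le> A"
    have "DERIV ?g y :> min 1 A * (1 - N / y\<^sup>2) - F' y"
      using Q y by (intro DERIV_diff DERIV_cmult dr dF) auto
    moreover have "min 1 y * (1 - N / y\<^sup>2) \<le> min 1 A * (1 - N / y\<^sup>2)"
      using Nx[OF y(1)] y by (intro mult_right_mono) auto
    hence "min 1 A * (1 - N / y\<^sup>2) - F' y \<ge> 0" using F'_le[OF y(1)] by linarith
    ultimately show "\<exists>z. DERIV ?g y :> z \<and> z \<ge> 0" by blast
  qed
  thus "\<Delta> \<le> min 1 A * R" unfolding \<Delta> R by (simp add: right_diff_distrib)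
  \<comment> \<open>On the upper half of the interval \<open>min 1 x\<close> is at least half of \<open>min 1 A\<close>, and by
    convexity \<open>r\<close> gains at least half of its variation there.\<close>
  define M where "M = (A + Q) / 2"
  have M: "Q \<le> M" "M \<le> A" "A / 2 \<le> M" "M > 0" using pos Q by (auto simp: M_def)
  have "F Q \<le> F M"
  proof (rule DERIV_nonneg_imp_nondecreasing[OF M(1)])
    fix y assume y: "Q \<le> y" "y \<le> M"
    have "0 \<le> min 1 y / 10 * (1 - N / y\<^sup>2)" using Nx[OF y(1)] Q y by simp
    hence "0 \<le> F' y" using F'_ge[OF y(1)] by linarith
    moreover have "DERIV F y :> F' y" using Q y by (intro dF) auto
    ultimately show "\<exists>z. DERIV F y :> z \<and> z \<ge> 0" by blast
  qed
  let ?g = "\<lambda>y. F y - min 1 A / 20 * r y"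
  have "?g M \<le> ?g A"
  proof (rule DERIV_nonneg_imp_nondecreasing[where f = ?g, OF M(2)])
    fix y assume y: "M \<le> y" "y \<le> A"
    hence Qy: "Q \<le> y" using M by simp
    have "DERIV ?g y :> F' y - min 1 A / 20 * (1 - N / y\<^sup>2)"
      using M y by (intro DERIV_diff DERIV_cmult dr dF) auto
    moreover have "min 1 A / 20 * (1 - N / y\<^sup>2) \<le> min 1 y / 10 * (1 - N / y\<^sup>2)"
      using Nx[OF Qy] y M by (intro mult_right_mono) (auto simp: min_def)
    hence "F' y - min 1 A / 20 * (1 - N / y\<^sup>2) \<ge> 0" using F'_ge[OF Qy] by linarith
    ultimately show "\<exists>z. DERIV ?g y :> z \<and> z \<ge> 0" by blast
  qed
  hence 1: "min 1 A / 20 * (r A - r M) \<le> F A - F M" by (simp add: right_diff_distrib)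
  have 2: "R / 2 \<le> r A - r M"
  proof -
    have "2 * (N / M) \<le> N / A + N / Q"
    proof -
      have "4 * A * Q \<le> (A + Q) * (A + Q)"
        using zero_le_square[of "A - Q"] by (simp add: algebra_simps)
      hence "4 / (A + Q) \<le> 1 / A + 1 / Q" using A Q by (simp add: field_simps)
      hence "N * (4 / (A + Q)) \<le> N * (1 / A + 1 / Q)" using N by (intro mult_left_mono) auto
      thus ?thesis by (simp add: M_def algebra_simps)
    qed
    hence "N / M \<le> (N / A + N / Q) / 2" by (simp add: mult.commute)
    hence "(A - M) + (N / A - (N / A + N / Q) / 2) \<le> r A - r M" by (simp add: r_def)
    moreover have "(A - M) + (N / A - (N / A + N / Q) / 2) = R / 2"
      unfolding R r_def M_def by (simp only: add_divide_distrib diff_divide_distrib) simp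
    ultimately show ?thesis by simp
  qed
  have "min 1 A * R / 40 = min 1 A / 20 * (R / 2)" by simp
  also have "\<dots> \<le> min 1 A / 20 * (r A - r M)" using A by (intro mult_left_mono 2) auto
  also note 1
  also have "F A - F M \<le> \<Delta>" unfolding \<Delta> using \<open>F Q \<le> F M\<close> by simp
  finally show "min 1 A * R / 40 \<le> \<Delta>" .
qed

lemma min_one_scale_le: "c \<ge> 1 \<Longrightarrow> x \<ge> 0 \<Longrightarrow> min 1 (c * x) \<le> c * min 1 (x::real)"
proof -
  assume "c \<ge> 1" "x \<ge> 0"
  moreover from this have "1 * x \<le> c * x" by (intro mult_right_mono) auto
  ultimately show ?thesis by (auto simp: min_def)
qed

text \<open>
  Factoring \<open>sinh A * sinh B\<close> out of the determinant turns the sum into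
  \<open>1 - exp (- \<Delta>)\<close>. Since \<open>R \<le> A\<close>, the quantities \<open>min 1 (min 1 A * R)\<close> and \<open>min 1 A * min 1 R\<close>
  coincide.
\<close>

lemma B2_alternating_sum_bounds:
  fixes A B P Q :: real
  assumes pos: "0 < B" "B \<le> P" "P \<le> A" "B \<le> Q" "Q \<le> A" and AB: "A * B = P * Q"
  defines "R \<equiv> A + B - P - Q"
  defines "f \<equiv> (1 - exp (-(2*A))) * (1 - exp (-(2*B)))
      - exp (- R) * ((1 - exp (-(2*P))) * (1 - exp (-(2*Q))))"
  shows "(1 - exp (-(2*A))) * (1 - exp (-(2*B))) * (min 1 A * min 1 R / 80) \<le> f"
    and "f \<le> (1 - exp (-(2*A))) * (1 - exp (-(2*B))) * (min 1 A * min 1 R)"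
proof -
  define \<Delta> where "\<Delta> = ln (sinh A) + ln (sinh B) - ln (sinh P) - ln (sinh Q)"
  have pos': "A > 0" "P > 0" "Q > 0" using pos by auto
  have "R * Q = (A - Q) * (Q - B)" using AB by (simp add: R_def algebra_simps)
  also have "\<dots> \<ge> 0" using pos by simp
  finally have R0: "R \<ge> 0" using pos' by (simp add: zero_le_mult_iff)
  have RA: "R \<le> A" using pos by (simp add: R_def)
  have \<Delta>: "min 1 A * R / 40 \<le> \<Delta> \<and> \<Delta> \<le> min 1 A * R"
  proof (cases "P \<le> Q")
    case True
    thus ?thesis using ln_sinh_hyperbola_bounds[of P Q A B] pos pos' AB by (simp add: R_def \<Delta>_def)
  next
    case False
    thus ?thesis using ln_sinh_hyperbola_bounds[of Q P A B] pos pos' AB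
      by (simp add: R_def \<Delta>_def algebra_simps)
  qed
  have sinh: "1 - exp (-(2*x)) = 2 * exp (- x) * sinh x" for x :: real
    by (simp add: sinh_field_def field_simps flip: exp_add)
  define a where "a = (1 - exp (-(2*A))) * (1 - exp (-(2*B)))"
  have a: "a > 0" using pos pos' by (simp add: a_def)
  have f: "f = a * (1 - exp (- \<Delta>))"
  proof -
    have "exp (- \<Delta>) = sinh P * sinh Q / (sinh A * sinh B)"
      using pos pos' by (simp add: \<Delta>_def exp_diff exp_add exp_minus field_simps)
    moreover have "a = 4 * exp (- A - B) * (sinh A * sinh B)"
      unfolding a_def sinh by (simp add: exp_diff exp_minus field_simps)
    moreover have "sinh A * sinh B > 0" using pos pos' by simp
    ultimately have "a * exp (- \<Delta>) = 4 * exp (- A - B) * (sinh P * sinh Q)"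
      using pos pos' by simp
    also have "\<dots> = exp (- R) * ((1 - exp (-(2*P))) * (1 - exp (-(2*Q))))"
      unfolding sinh R_def by (simp add: exp_diff exp_minus exp_add field_simps)
    finally show ?thesis by (simp add: f_def a_def right_diff_distrib)
  qed
  have \<Delta>0: "\<Delta> \<ge> 0"
  proof -
    have "0 \<le> min 1 A * R / 40" using pos' R0 by simp
    with \<Delta> show ?thesis by linarith
  qed
  have m: "min 1 A * min 1 R \<le> min 1 (min 1 A * R)"
    using R0 pos' by (auto simp: min_def mult_le_one)
  have "min 1 A * min 1 R / 80 \<le> min 1 \<Delta> / 2"
  proof -
    have "min 1 A * min 1 R \<le> 40 * min 1 \<Delta>" using \<Delta> m by (auto simp: min_def split: if_splits)
    thus ?thesis by linarith
  qed
  also have "\<dots> \<le> 1 - exp (- \<Delta>)" by (rule one_minus_exp_ge_min[OF \<Delta>0])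
  finally show "(1 - exp (-(2*A))) * (1 - exp (-(2*B))) * (min 1 A * min 1 R / 80) \<le> f"
    unfolding f a_def[symmetric] using a by (intro mult_left_mono) auto
  have "1 - exp (- \<Delta>) \<le> min 1 (min 1 A * R)"
    using one_minus_exp_le_min[OF \<Delta>0] \<Delta> by auto
  also have "\<dots> \<le> min 1 A * min 1 R"
  proof (cases "A \<le> 1")
    case True
    hence "min 1 A = A" "min 1 R = R" using RA by auto
    thus ?thesis by simp
  qed simp
  finally show "f \<le> (1 - exp (-(2*A))) * (1 - exp (-(2*B))) * (min 1 A * min 1 R)"
    unfolding f a_def[symmetric] using a by (intro mult_left_mono) auto
qed

section \<open>The dihedral group and the reduction to an alternating sum\<close>

definition rot_matrix :: "real \<Rightarrow> real ^ 2 ^ 2" where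
  "rot_matrix b = vector [vector [cos b, - sin b], vector [sin b, cos b]]"

text \<open>
  The reflection in the line perpendicular to the direction of angle \<open>b / 2\<close>.
\<close>

definition mirror_matrix :: "real \<Rightarrow> real ^ 2 ^ 2" where
  "mirror_matrix b = vector [vector [- cos b, - sin b], vector [- sin b, cos b]]"

lemma mirror_mult_mirror: "mirror_matrix b ** mirror_matrix c = rot_matrix (b - c)"
  by (simp add: vec_eq_iff forall_2 matrix_matrix_mult_def sum_2 mirror_matrix_def
      rot_matrix_def cos_diff sin_diff algebra_simps)

lemma mirror_mult_rotation: "mirror_matrix b ** rot_matrix c = mirror_matrix (b - c)"
  by (simp add: vec_eq_iff forall_2 matrix_matrix_mult_def sum_2 mirror_matrix_def
      rot_matrix_def cos_diff sin_diff algebra_simps)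

lemma rotation_mult_mirror: "rot_matrix b ** mirror_matrix c = mirror_matrix (b + c)"
  by (simp add: vec_eq_iff forall_2 matrix_matrix_mult_def sum_2 mirror_matrix_def
      rot_matrix_def cos_add sin_add algebra_simps)

lemma rotation_mult_rotation: "rot_matrix b ** rot_matrix c = rot_matrix (b + c)"
  by (simp add: vec_eq_iff forall_2 matrix_matrix_mult_def sum_2
      rot_matrix_def cos_add sin_add algebra_simps)

lemma rot_matrix_0: "rot_matrix 0 = mat 1"
  by (simp add: vec_eq_iff forall_2 rot_matrix_def mat_def)

lemma det_rot_matrix: "det (rot_matrix b) = 1"
  using sin_cos_squared_add[of b] by (simp add: det_2 rot_matrix_def power2_eq_square)

lemma det_mirror_matrix: "det (mirror_matrix b) = -1"
  using sin_cos_squared_add[of b] by (simp add: det_2 mirror_matrix_def power2_eq_square)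

lemma orthogonal_mirror_matrix: "orthogonal_matrix (mirror_matrix b)"
proof -
  have "transpose (mirror_matrix b) = mirror_matrix b"
    by (simp add: vec_eq_iff forall_2 transpose_def mirror_matrix_def)
  thus ?thesis by (simp add: orthogonal_matrix mirror_mult_mirror rot_matrix_0)
qed

lemma reflection_matrix_eq_mirror: "reflection_matrix (vector [cos a, sin a]) = mirror_matrix (2 * a)"
proof -
  have "cos a * cos a = 1 - sin a * sin a"
    using sin_cos_squared_add[of a] by (simp add: power2_eq_square)
  thus ?thesis
    by (simp add: vec_eq_iff forall_2 reflection_matrix_def mirror_matrix_def matrix_def
        inner_vec_def sum_2 axis_def cos_double sin_double power2_eq_square)
qed

text \<open>
  The index is an integer so that sums and differences of angles are again such angles; only its
  residue modulo \<open>m\<close> matters for the matrices.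
\<close>

definition dihedral_angle :: "nat \<Rightarrow> int \<Rightarrow> real" where
  "dihedral_angle m k = 2 * pi * real_of_int k / real m"

lemma dihedral_angle_simps:
  "dihedral_angle m j + dihedral_angle m k = dihedral_angle m (j + k)"
  "dihedral_angle m j - dihedral_angle m k = dihedral_angle m (j - k)"
  "dihedral_angle m 0 = 0"
  by (simp_all add: dihedral_angle_def algebra_simps add_divide_distrib diff_divide_distrib)

lemma cos_sin_dihedral_angle_eq_iff:
  assumes "m > 0"
  shows "sin (dihedral_angle m j) = sin (dihedral_angle m k) \<and>
      cos (dihedral_angle m j) = cos (dihedral_angle m k) \<longleftrightarrow> j mod int m = k mod int m"
proof -
  have "(dihedral_angle m j = dihedral_angle m k + 2 * pi * real_of_int n) \<longleftrightarrow> j = k + int m * n" for n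
  proof -
    have "dihedral_angle m k + 2 * pi * real_of_int n = dihedral_angle m (k + int m * n)"
      using assms by (simp add: dihedral_angle_def field_simps)
    thus ?thesis using assms by (simp add: dihedral_angle_def del: of_int_add of_int_mult)
  qed
  thus ?thesis unfolding sin_cos_eq_iff by (simp add: mod_eq_dvd_iff dvd_def algebra_simps)
qed

lemma rotation_mirror_mod:
  assumes "m > 0"
  shows "rot_matrix (dihedral_angle m (k mod int m)) = rot_matrix (dihedral_angle m k)"
    and "mirror_matrix (dihedral_angle m (k mod int m)) = mirror_matrix (dihedral_angle m k)"
  using cos_sin_dihedral_angle_eq_iff[OF assms, of "k mod int m" k]
  by (simp_all add: rot_matrix_def mirror_matrix_def)

lemma rotation_mirror_image:
  assumes "m > 0"
  shows "(\<lambda>k. rot_matrix (dihedral_angle m (int k))) ` {..<m} = 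
      range (\<lambda>k. rot_matrix (dihedral_angle m k))"
    and "(\<lambda>k. mirror_matrix (dihedral_angle m (int k))) ` {..<m} = range (\<lambda>k. mirror_matrix (dihedral_angle m k))"
proof -
  have *: "\<exists>j<m. int j = k mod int m" for k
    using assms by (intro exI[of _ "nat (k mod int m)"]) (auto simp: nat_less_iff)
  have "(\<lambda>k. F (dihedral_angle m (int k))) ` {..<m} = range (\<lambda>k. F (dihedral_angle m k))"
    if "\<And>k. F (dihedral_angle m (k mod int m)) = F (dihedral_angle m k)" for F :: "real \<Rightarrow> real ^ 2 ^ 2"
  proof safe
    fix k
    obtain j where "j < m" "int j = k mod int m" using * by blast
    thus "F (dihedral_angle m k) \<in> (\<lambda>k. F (dihedral_angle m (int k))) ` {..<m}"
      using that[of k] by (intro image_eqI[of _ _ j]) auto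
  qed auto
  from this[of rot_matrix] this[of mirror_matrix] show
    "(\<lambda>k. rot_matrix (dihedral_angle m (int k))) ` {..<m} = range (\<lambda>k. rot_matrix (dihedral_angle m k))"
    "(\<lambda>k. mirror_matrix (dihedral_angle m (int k))) ` {..<m} = range (\<lambda>k. mirror_matrix (dihedral_angle m k))"
    using rotation_mirror_mod[OF assms] by blast+
qed

lemma rotation_mirror_inj:
  assumes "m > 0"
  shows "inj_on (\<lambda>k. rot_matrix (dihedral_angle m (int k))) {..<m}"
    and "inj_on (\<lambda>k. mirror_matrix (dihedral_angle m (int k))) {..<m}"
proof -
  have "i = j" if "i < m" "j < m"
    "sin (dihedral_angle m (int i)) = sin (dihedral_angle m (int j))"
    "cos (dihedral_angle m (int i)) = cos (dihedral_angle m (int j))" for i j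
    using cos_sin_dihedral_angle_eq_iff[OF assms, of "int i" "int j"] that by simp
  thus "inj_on (\<lambda>k. rot_matrix (dihedral_angle m (int k))) {..<m}"
    "inj_on (\<lambda>k. mirror_matrix (dihedral_angle m (int k))) {..<m}"
    by (auto simp: inj_on_def rot_matrix_def mirror_matrix_def vec_eq_iff forall_2)
qed

lemma inv_mirror_matrix: "inv\<^bsub>orthogonal_group2\<^esub> (mirror_matrix b) = mirror_matrix b"
proof -
  interpret monoid orthogonal_group2
    by unfold_locales
      (auto simp: orthogonal_group2_def orthogonal_matrix_mul orthogonal_matrix_id matrix_mul_assoc)
  have "mirror_matrix b \<in> carrier orthogonal_group2"
    by (simp add: orthogonal_group2_def orthogonal_mirror_matrix)
  moreover have "mirror_matrix b \<otimes>\<^bsub>orthogonal_group2\<^esub> mirror_matrix b = \<one>\<^bsub>orthogonal_group2\<^esub>"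
    by (simp add: orthogonal_group2_def mirror_mult_mirror rot_matrix_0)
  ultimately show ?thesis using inv_unique' by metis
qed

text \<open>
  The rotations and mirrors are closed under products, and each rotation is the product of two
  mirrors, which are the generators.
\<close>

lemma dihedral_reflection_group_eq:
  assumes "m > 0"
  shows "dihedral_reflection_group m =
    (\<lambda>k. rot_matrix (dihedral_angle m (int k))) ` {..<m} \<union>
    (\<lambda>k. mirror_matrix (dihedral_angle m (int k))) ` {..<m}" (is "_ = ?R \<union> ?M")
proof -
  let ?G = orthogonal_group2
  define gens where "gens = (\<lambda>j. reflection_matrix
    (vector [cos (pi * real j / real m), sin (pi * real j / real m)]) :: real ^ 2 ^ 2) ` {0..2 * m - 1}"
  have gens: "gens = (\<lambda>j. mirror_matrix (dihedral_angle m (int j))) ` {0..2 * m - 1}"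
    unfolding gens_def reflection_matrix_eq_mirror
    by (simp add: dihedral_angle_def mult.assoc times_divide_eq_right)
  have RM: "?R = range (\<lambda>k. rot_matrix (dihedral_angle m k))"
    "?M = range (\<lambda>k. mirror_matrix (dihedral_angle m k))"
    using rotation_mirror_image[OF assms] by auto
  have mult: "g \<otimes>\<^bsub>?G\<^esub> h = g ** h" for g h by (simp add: orthogonal_group2_def)
  have "g \<in> ?R \<union> ?M" if "g \<in> generate ?G gens" for g
    using that
  proof induction
    case one
    have "rot_matrix (dihedral_angle m 0) \<in> ?R" unfolding RM by blast
    thus ?case by (simp add: orthogonal_group2_def dihedral_angle_simps rot_matrix_0)
  next
    case (incl h)
    thus ?case unfolding RM gens by auto
  next
    case (inv h)
    thus ?case unfolding RM gens by (auto simp: inv_mirror_matrix)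
  next
    case (eng g h)
    thus ?case unfolding RM mult
      by (auto simp: mirror_mult_mirror mirror_mult_rotation rotation_mult_mirror
          rotation_mult_rotation dihedral_angle_simps)
  qed
  moreover have M: "?M \<subseteq> generate ?G gens"
    unfolding gens by (auto intro!: generate.incl)
  moreover have "?R \<subseteq> generate ?G gens"
  proof
    fix g assume "g \<in> ?R"
    then obtain k where g: "g = rot_matrix (dihedral_angle m (int k))" "k < m" by auto
    have "mirror_matrix (dihedral_angle m (int j)) \<in> generate ?G gens" if "j < m" for j
      using M that by blast
    hence "mirror_matrix (dihedral_angle m (int k)) \<otimes>\<^bsub>?G\<^esub> mirror_matrix (dihedral_angle m (int 0)) \<in> generate ?G gens"
      using assms g by (intro generate.eng) blast+
    thus "g \<in> generate ?G gens"
      by (simp add: mult mirror_mult_mirror dihedral_angle_simps g)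
  qed
  ultimately show ?thesis unfolding dihedral_reflection_group_def gens_def[symmetric] by blast
qed

lemma cone_heat_kernel_eq:
  assumes "m > 0"
  shows "cone_heat_kernel m t u v =
    (\<Sum>k<m. gauss_weierstrass t (rot_matrix (dihedral_angle m (int k)) *v u - v)
          - gauss_weierstrass t (mirror_matrix (dihedral_angle m (int k)) *v u - v))"
proof -
  let ?R = "\<lambda>k. rot_matrix (dihedral_angle m (int k))"
  let ?M = "\<lambda>k. mirror_matrix (dihedral_angle m (int k))"
  have disj: "?R ` {..<m} \<inter> ?M ` {..<m} = {}"
  proof -
    have "rot_matrix b \<noteq> mirror_matrix c" for b c
      using det_rot_matrix[of b] det_mirror_matrix[of c] by auto
    thus ?thesis by auto
  qed
  have "cone_heat_kernel m t u v =
      (\<Sum>g\<in>?R ` {..<m}. det g * gauss_weierstrass t (g *v u - v)) +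
      (\<Sum>g\<in>?M ` {..<m}. det g * gauss_weierstrass t (g *v u - v))"
    unfolding cone_heat_kernel_def dihedral_reflection_group_eq[OF assms]
    using disj by (intro sum.union_disjoint) auto
  thus ?thesis
    by (simp add: sum.reindex[OF rotation_mirror_inj(1)[OF assms]]
        sum.reindex[OF rotation_mirror_inj(2)[OF assms]]
        det_rot_matrix det_mirror_matrix sum_subtractf sum_negf)
qed

lemma gauss_weierstrass_Pair:
  fixes a :: "'a::euclidean_space" and b :: "'b::euclidean_space"
  assumes "t > 0"
  shows "gauss_weierstrass t (a, b) = gauss_weierstrass t a * gauss_weierstrass t b"
proof -
  have "(4 * pi * t) powr (- (real DIM('a \<times> 'b) / 2)) =
      (4 * pi * t) powr (- (real DIM('a) / 2)) * (4 * pi * t) powr (- (real DIM('b) / 2))"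
    by (simp add: add_divide_distrib flip: powr_add)
  moreover have "exp (- (norm (a, b))\<^sup>2 / (4 * t)) =
      exp (- (norm a)\<^sup>2 / (4 * t)) * exp (- (norm b)\<^sup>2 / (4 * t))"
    by (simp add: norm_Pair add_divide_distrib diff_divide_distrib flip: exp_add)
  ultimately show ?thesis unfolding gauss_weierstrass_def by simp
qed

lemma gauss_weierstrass_orthogonal_shift:
  fixes u v w :: "'a::euclidean_space"
  assumes "t > 0" "norm w = norm u"
  shows "gauss_weierstrass t (w - v) =
    gauss_weierstrass t (u - v) * exp (- ((u \<bullet> v - w \<bullet> v) / (2 * t)))"
proof -
  have "(norm (w - v))\<^sup>2 = (norm (u - v))\<^sup>2 + 2 * (u \<bullet> v - w \<bullet> v)"
    using assms(2)
    by (simp add: power2_norm_eq_inner norm_eq inner_diff_left inner_diff_right inner_commute)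
  moreover have "- (n + 2 * d) / (4 * t) = - n / (4 * t) + - (d / (2 * t))" for n d
    using assms(1) by (simp add: field_simps)
  ultimately have "- (norm (w - v))\<^sup>2 / (4 * t) =
      - (norm (u - v))\<^sup>2 / (4 * t) + - ((u \<bullet> v - w \<bullet> v) / (2 * t))"
    by (simp only:)
  thus ?thesis unfolding gauss_weierstrass_def by (simp only: exp_add mult.assoc)
qed

lemma rot_matrix_mult_vec:
  "rot_matrix b *v u = vector [cos b * u $ 1 - sin b * u $ 2, sin b * u $ 1 + cos b * u $ 2]"
  by (simp add: vec_eq_iff forall_2 matrix_vector_mult_def sum_2 rot_matrix_def)

lemma mirror_matrix_mult_vec:
  "mirror_matrix b *v u = vector [- cos b * u $ 1 - sin b * u $ 2, - sin b * u $ 1 + cos b * u $ 2]"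
  by (simp add: vec_eq_iff forall_2 matrix_vector_mult_def sum_2 mirror_matrix_def)

lemma inner_real2: "(u :: real ^ 2) \<bullet> v = u $ 1 * v $ 1 + u $ 2 * v $ 2"
  by (simp add: inner_vec_def sum_2)

definition alternating_sum :: "nat \<Rightarrow> real \<Rightarrow> real ^ 2 \<Rightarrow> real ^ 2 \<Rightarrow> real" where
  "alternating_sum m t u v =
    (\<Sum>k<m. exp (- ((u \<bullet> v - (rot_matrix (dihedral_angle m (int k)) *v u) \<bullet> v) / (2 * t)))
          - exp (- ((u \<bullet> v - (mirror_matrix (dihedral_angle m (int k)) *v u) \<bullet> v) / (2 * t))))"

lemma wedge_heat_kernel_eq:
  fixes x y :: "(real ^ 'n) \<times> (real ^ 2)"
  assumes "m > 0" "t > 0"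
  shows "wedge_heat_kernel m t x y = alternating_sum m t (snd x) (snd y) * gauss_weierstrass t (x - y)"
proof -
  have "norm (rot_matrix b *v u) = norm u \<and> norm (mirror_matrix b *v u) = norm u" for b u
  proof -
    have "cos b * cos b + sin b * sin b = 1"
      using sin_cos_squared_add2[of b] by (simp add: power2_eq_square)
    hence "(cos b * p - sin b * q) * (cos b * p - sin b * q) +
        (sin b * p + cos b * q) * (sin b * p + cos b * q) = p * p + q * q"
      "(- cos b * p - sin b * q) * (- cos b * p - sin b * q) +
        (- sin b * p + cos b * q) * (- sin b * p + cos b * q) = p * p + q * q" for p q :: real
      by algebra+
    thus ?thesis
      by (simp only: norm_eq rot_matrix_mult_vec mirror_matrix_mult_vec inner_real2 vector_2)
  qed
  hence n: "norm (rot_matrix b *v u) = norm u" "norm (mirror_matrix b *v u) = norm u" for b u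
    by auto
  have "gauss_weierstrass t (x - y) = gauss_weierstrass t (fst x - fst y) * gauss_weierstrass t (snd x - snd y)"
    using gauss_weierstrass_Pair[OF assms(2), of "fst x - fst y" "snd x - snd y"]
    by (simp add: minus_prod_def)
  thus ?thesis
    unfolding wedge_heat_kernel_def cone_heat_kernel_eq[OF assms(1)] alternating_sum_def
      gauss_weierstrass_orthogonal_shift[OF assms(2) n(1)] gauss_weierstrass_orthogonal_shift[OF assms(2) n(2)]
    by (simp add: sum_distrib_left sum_distrib_right algebra_simps)
qed

section \<open>Distances to the sides and to the edge\<close>

lemma infdist_eqI:
  assumes "z \<in> A" "dist x z = d" "\<And>y. y \<in> A \<Longrightarrow> d \<le> dist x y"
  shows "infdist x A = d"
proof (rule antisym)
  show "infdist x A \<le> d" using infdist_le[OF assms(1)] assms(2) by metis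
  have "A \<noteq> {}" using assms(1) by auto
  thus "d \<le> infdist x A" using assms(3) by (auto simp: infdist_notempty intro: cINF_greatest)
qed

text \<open>
  Moving from \<open>z\<close> a little in the direction of \<open>x\<close> makes both inner products positive.
\<close>

lemma closure_two_halfspaces:
  fixes x z n1 n2 :: "'a::real_inner"
  assumes "x \<bullet> n1 > 0" "x \<bullet> n2 > 0" "z \<bullet> n1 \<ge> 0" "z \<bullet> n2 \<ge> 0"
  shows "z \<in> closure {x. x \<bullet> n1 > 0 \<and> x \<bullet> n2 > 0}"
  unfolding closure_approachable
proof safe
  fix e :: real assume e: "e > 0"
  define c where "c = e / 2 / (norm x + 1)"
  have c: "c > 0" using e by (simp add: c_def add_nonneg_pos)
  have "c * norm x \<le> c * (norm x + 1)" using c by simp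
  also have "c * (norm x + 1) = e / 2"
  proof -
    have "b \<noteq> 0 \<Longrightarrow> a / b * b = a" for a b :: real by simp
    moreover have "norm x + 1 \<noteq> 0" using norm_ge_zero[of x] by linarith
    ultimately show ?thesis unfolding c_def by blast
  qed
  finally have "dist (z + c *\<^sub>R x) z < e" using c e by (simp add: dist_norm)
  moreover have "z + c *\<^sub>R x \<in> {x. x \<bullet> n1 > 0 \<and> x \<bullet> n2 > 0}"
    using assms c by (simp add: inner_add_left add_nonneg_pos)
  ultimately show "\<exists>y\<in>{x. x \<bullet> n1 > 0 \<and> x \<bullet> n2 > 0}. dist y z < e" by blast
qed

text \<open>
  Because the normals form an obtuse or right angle, the orthogonal projection of \<open>x\<close> to the
  hyperplane stays on the nonnegative side of the other hyperplane, so it lies on the face.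
\<close>

lemma infdist_face:
  fixes x n1 n2 :: "'a::real_inner"
  assumes "norm n1 = 1" "n1 \<bullet> n2 \<le> 0" "x \<bullet> n1 > 0" "x \<bullet> n2 > 0"
  shows "infdist x (closure {x. x \<bullet> n1 > 0 \<and> x \<bullet> n2 > 0} \<inter> {x. x \<bullet> n1 = 0}) = x \<bullet> n1"
proof (rule infdist_eqI)
  let ?z = "x - (x \<bullet> n1) *\<^sub>R n1"
  have "n1 \<bullet> n1 = 1" using assms(1) by (simp add: norm_eq_1)
  hence z1: "?z \<bullet> n1 = 0" by (simp add: inner_diff_left)
  have "(x \<bullet> n1) * (n1 \<bullet> n2) \<le> 0" using assms by (intro mult_nonneg_nonpos) auto
  hence "?z \<bullet> n2 \<ge> 0" using assms by (simp add: inner_diff_left)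
  thus "?z \<in> closure {x. x \<bullet> n1 > 0 \<and> x \<bullet> n2 > 0} \<inter> {x. x \<bullet> n1 = 0}"
    using closure_two_halfspaces[OF assms(3,4), of ?z] z1 by simp
  show "dist x ?z = x \<bullet> n1" using assms by (simp add: dist_norm)
next
  fix y assume "y \<in> closure {x. x \<bullet> n1 > 0 \<and> x \<bullet> n2 > 0} \<inter> {x. x \<bullet> n1 = 0}"
  hence "x \<bullet> n1 = (x - y) \<bullet> n1" by (simp add: inner_diff_left)
  also have "\<dots> \<le> norm (x - y) * norm n1" by (rule norm_cauchy_schwarz)
  finally show "x \<bullet> n1 \<le> dist x y" using assms by (simp add: dist_norm)
qed

lemma inner_wedge_normals:
  fixes x :: "(real ^ 'n) \<times> (real ^ 2)"
  shows "x \<bullet> wedge_normal1 2 = snd x $ 2" "x \<bullet> wedge_normal2 2 = snd x $ 1"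
    "x \<bullet> wedge_normal1 3 = (snd x $ 1 + sqrt 3 * snd x $ 2) / 2"
    "x \<bullet> wedge_normal2 3 = (snd x $ 1 - sqrt 3 * snd x $ 2) / 2"
    "x \<bullet> wedge_normal1 4 = snd x $ 2" "x \<bullet> wedge_normal2 4 = (snd x $ 1 - snd x $ 2) / sqrt 2"
proof -
  show "x \<bullet> wedge_normal1 2 = snd x $ 2" "x \<bullet> wedge_normal2 2 = snd x $ 1" 
     "x \<bullet> wedge_normal1 4 = snd x $ 2"
    by (simp_all add: wedge_normal1_def wedge_normal2_def inner_prod_def inner_real2)
  show "x \<bullet> wedge_normal1 3 = (snd x $ 1 + sqrt 3 * snd x $ 2) / 2"
    "x \<bullet> wedge_normal2 3 = (snd x $ 1 - sqrt 3 * snd x $ 2) / 2"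
    by (simp_all add: wedge_normal1_def wedge_normal2_def inner_prod_def inner_real2 sin_30 cos_30
        field_simps)
  have "a * sqrt 2 / 2 = a / sqrt 2" for a by (simp add: field_simps)
  thus "x \<bullet> wedge_normal2 4 = (snd x $ 1 - snd x $ 2) / sqrt 2"
    by (simp add: wedge_normal1_def wedge_normal2_def inner_prod_def inner_real2 sin_45 cos_45
        diff_divide_distrib)
qed

lemma wedge_normals_props:
  assumes "m \<in> {2, 3, 4}"
  shows "norm (wedge_normal1 m :: (real ^ 'n) \<times> (real ^ 2)) = 1"
    and "norm (wedge_normal2 m :: (real ^ 'n) \<times> (real ^ 2)) = 1"
    and "(wedge_normal1 m :: (real ^ 'n) \<times> (real ^ 2)) \<bullet> wedge_normal2 m \<le> 0"
proof -
  let ?n1 = "wedge_normal1 m :: (real ^ 'n) \<times> (real ^ 2)"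
  let ?n2 = "wedge_normal2 m :: (real ^ 'n) \<times> (real ^ 2)"
  show "norm ?n1 = 1" "norm ?n2 = 1"
    by (simp_all add: norm_eq_1 wedge_normal1_def wedge_normal2_def inner_prod_def inner_real2
        flip: power2_eq_square)
  show "?n1 \<bullet> ?n2 \<le> 0"
    using assms by (auto simp: wedge_normal1_def wedge_normal2_def inner_prod_def inner_real2
        sin_30 cos_30 cos_45 sin_45)
qed

lemma wedge_normals_span:
  fixes y :: "(real ^ 'n) \<times> (real ^ 2)"
  assumes "m \<in> {2, 3, 4}" "y \<bullet> wedge_normal1 m = 0" "y \<bullet> wedge_normal2 m = 0"
  shows "snd y = 0"
  using assms by (auto simp: inner_wedge_normals vec_eq_iff forall_2)

lemma infdist_wedge_sides:
  fixes x :: "(real ^ 'n) \<times> (real ^ 2)"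
  assumes "m \<in> {2, 3, 4}" "x \<in> wedge m"
  shows "infdist x (wedge_side1 m) = x \<bullet> wedge_normal1 m"
    and "infdist x (wedge_side2 m) = x \<bullet> wedge_normal2 m"
proof -
  note n = wedge_normals_props[OF assms(1), where ?'n = 'n]
  have x: "x \<bullet> wedge_normal1 m > 0" "x \<bullet> wedge_normal2 m > 0"
    using assms(2) by (auto simp: wedge_def)
  show "infdist x (wedge_side1 m) = x \<bullet> wedge_normal1 m"
    unfolding wedge_side1_def wedge_def using n x by (intro infdist_face)
  show "infdist x (wedge_side2 m) = x \<bullet> wedge_normal2 m"
    unfolding wedge_side2_def wedge_def
    using infdist_face[of "wedge_normal2 m" "wedge_normal1 m" x] n x
    by (simp add: conj_commute inner_commute)
qed

lemma infdist_wedge_edge: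
  fixes x :: "(real ^ 'n) \<times> (real ^ 2)"
  assumes "m \<in> {2, 3, 4}" "x \<in> wedge m"
  shows "infdist x (wedge_edge m) = norm (snd x)"
proof (rule infdist_eqI)
  let ?z = "(fst x, 0) :: (real ^ 'n) \<times> (real ^ 2)"
  have z: "?z \<bullet> wedge_normal1 m = 0" "?z \<bullet> wedge_normal2 m = 0"
    by (simp_all add: wedge_normal1_def wedge_normal2_def)
  thus "?z \<in> wedge_edge m"
    using assms closure_two_halfspaces[of x "wedge_normal1 m" "wedge_normal2 m" ?z]
    by (auto simp: wedge_edge_def wedge_side1_def wedge_side2_def wedge_def)
  show "dist x ?z = norm (snd x)"
    by (cases x) (simp add: dist_Pair_Pair)
next
  fix y :: "(real ^ 'n) \<times> (real ^ 2)" assume "y \<in> wedge_edge m"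
  hence "snd y = 0"
    by (intro wedge_normals_span[OF assms(1)]) (simp_all add: wedge_edge_def wedge_side1_def wedge_side2_def)
  thus "norm (snd x) \<le> dist x y" using dist_snd_le[of x y] by simp
qed

section \<open>The alternating sums in coordinates\<close>

lemma alternating_sum_2:
  assumes "t > 0"
  shows "alternating_sum 2 t u v =
    (1 - exp (- (u $ 2 * v $ 2 / t))) * (1 - exp (- (u $ 1 * v $ 1 / t)))"
proof -
  define X Y where "X = u $ 1 * v $ 1 / t" and "Y = u $ 2 * v $ 2 / t"
  have a: "cos (dihedral_angle 2 0) = 1" "sin (dihedral_angle 2 0) = 0"
    "cos (dihedral_angle 2 1) = - 1" "sin (dihedral_angle 2 1) = 0"
    by (simp_all add: dihedral_angle_def)
  have s: "(\<Sum>k<2. F k) = F 0 + F 1" for F :: "nat \<Rightarrow> real"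
    by (simp add: numeral_2_eq_2)
  define R M where "R = (\<lambda>k. (u \<bullet> v - (rot_matrix (dihedral_angle 2 k) *v u) \<bullet> v) / (2 * t))"
    and "M = (\<lambda>k. (u \<bullet> v - (mirror_matrix (dihedral_angle 2 k) *v u) \<bullet> v) / (2 * t))"
  have "R 0 = 0" "R 1 = X + Y" "M 0 = X" "M 1 = Y"
    unfolding R_def M_def X_def Y_def rot_matrix_mult_vec mirror_matrix_mult_vec
      inner_real2 a vector_2 using assms
    by (simp_all add: field_simps)
  moreover have "alternating_sum 2 t u v = (\<Sum>k<2. exp (- R (int k)) - exp (- M (int k)))"
    by (simp add: alternating_sum_def R_def M_def)
  ultimately have "alternating_sum 2 t u v = 1 - exp (- X) - exp (- Y) + exp (- (X + Y))"
    by (simp add: s)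
  also have "\<dots> = (1 - exp (- Y)) * (1 - exp (- X))"
    by (simp add: algebra_simps flip: exp_add)
  finally show ?thesis by (simp add: X_def Y_def)
qed

lemma alternating_sum_3:
  fixes u v :: "real ^ 2"
  assumes "t > 0"
  defines "a1 \<equiv> (u $ 1 + sqrt 3 * u $ 2) / 2" and "a2 \<equiv> (u $ 1 - sqrt 3 * u $ 2) / 2"
  defines "b1 \<equiv> (v $ 1 + sqrt 3 * v $ 2) / 2" and "b2 \<equiv> (v $ 1 - sqrt 3 * v $ 2) / 2"
  defines "A \<equiv> a1 * b1 / t" and "B \<equiv> a2 * b2 / t" and "P \<equiv> a1 * b2 / t" and "Q \<equiv> a2 * b1 / t"
  shows "alternating_sum 3 t u v = (1 - exp (- A)) * (1 - exp (- B))
      - exp (- A - B) * ((1 - exp (- P)) * (1 - exp (- Q)))"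
proof -
  define r where "r = sqrt 3"
  have "r * r = 3" by (simp add: r_def)
  hence r: "r * r = 3" "r * (r * z) = 3 * z" for z by (simp_all flip: mult.assoc)
  have a: "cos (dihedral_angle 3 0) = 1" "sin (dihedral_angle 3 0) = 0"
    "cos (dihedral_angle 3 1) = - 1 / 2" "sin (dihedral_angle 3 1) = r / 2"
    "cos (dihedral_angle 3 2) = - 1 / 2" "sin (dihedral_angle 3 2) = - r / 2"
  proof -
    have "dihedral_angle 3 1 = pi - pi / 3" "dihedral_angle 3 2 = pi + pi / 3"
      by (simp_all add: dihedral_angle_def field_simps)
    moreover have "cos (pi - pi / 3) = - 1 / 2" "sin (pi - pi / 3) = r / 2"
      "cos (pi + pi / 3) = - 1 / 2" "sin (pi + pi / 3) = - r / 2"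
      unfolding cos_pi_minus sin_pi_minus cos_add sin_add by (simp_all add: cos_60 sin_60 r_def)
    ultimately show "cos (dihedral_angle 3 1) = - 1 / 2" "sin (dihedral_angle 3 1) = r / 2"
      "cos (dihedral_angle 3 2) = - 1 / 2" "sin (dihedral_angle 3 2) = - r / 2"
      by (simp_all only:)
  qed (simp_all add: dihedral_angle_def)
  have s: "(\<Sum>k<3. F k) = F 0 + F 1 + F 2" for F :: "nat \<Rightarrow> real"
    by (simp add: numeral_3_eq_3 numeral_2_eq_2)
  define p q p' q' where "p = u $ 1" and "q = u $ 2" and "p' = v $ 1" and "q' = v $ 2"
  define R M where "R = (\<lambda>k. (u \<bullet> v - (rot_matrix (dihedral_angle 3 k) *v u) \<bullet> v) / (2 * t))"
    and "M = (\<lambda>k. (u \<bullet> v - (mirror_matrix (dihedral_angle 3 k) *v u) \<bullet> v) / (2 * t))"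
  have "R 0 = 0" "R 1 = A + B + P" "R 2 = A + B + Q" "M 0 = A + B + P + Q" "M 1 = A" "M 2 = B"
  proof -
    have *: "x / (2 * t) = y / t" if "x = 2 * y" for x y using that by simp
    note defs = R_def M_def A_def B_def P_def Q_def a1_def a2_def b1_def b2_def
      r_def[symmetric] p_def[symmetric] q_def[symmetric] p'_def[symmetric] q'_def[symmetric]
      rot_matrix_mult_vec mirror_matrix_mult_vec inner_real2 a vector_2
    show "R 0 = 0" "R 1 = A + B + P" "R 2 = A + B + Q" "M 0 = A + B + P + Q" "M 1 = A" "M 2 = B"
      unfolding defs add_divide_distrib[symmetric]
      by (simp, (rule *, simp add: field_simps r)+)
  qed
  moreover have "alternating_sum 3 t u v = (\<Sum>k<3. exp (- R (int k)) - exp (- M (int k)))"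
    by (simp add: alternating_sum_def R_def M_def)
  ultimately have "alternating_sum 3 t u v =
      (1 - exp (- (A + B + P + Q))) + (exp (- (A + B + P)) - exp (- A)) + (exp (- (A + B + Q)) - exp (- B))"
    by (simp add: s)
  also have "\<dots> = (1 - exp (- A)) * (1 - exp (- B))
      - exp (- A - B) * ((1 - exp (- P)) * (1 - exp (- Q)))"
    by (simp add: algebra_simps flip: exp_add)
  finally show ?thesis .
qed

lemma alternating_sum_4:
  fixes u v :: "real ^ 2"
  assumes "t > 0"
  defines "A \<equiv> u $ 1 * v $ 1 / (2 * t)" and "B \<equiv> u $ 2 * v $ 2 / (2 * t)"
    and "P \<equiv> u $ 1 * v $ 2 / (2 * t)" and "Q \<equiv> u $ 2 * v $ 1 / (2 * t)"
  shows "alternating_sum 4 t u v = (1 - exp (- (2 * A))) * (1 - exp (- (2 * B)))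
      - exp (- (A + B - P - Q)) * ((1 - exp (- (2 * P))) * (1 - exp (- (2 * Q))))"
proof -
  have a: "cos (dihedral_angle 4 0) = 1" "sin (dihedral_angle 4 0) = 0"
    "cos (dihedral_angle 4 1) = 0" "sin (dihedral_angle 4 1) = 1"
    "cos (dihedral_angle 4 2) = - 1" "sin (dihedral_angle 4 2) = 0"
    "cos (dihedral_angle 4 3) = 0" "sin (dihedral_angle 4 3) = - 1"
  proof -
    have "dihedral_angle 4 1 = pi / 2" "dihedral_angle 4 2 = pi" "dihedral_angle 4 3 = pi + pi / 2"
      by (simp_all add: dihedral_angle_def field_simps)
    moreover have "cos (pi + pi / 2) = 0" "sin (pi + pi / 2) = - 1"
      "cos (pi / 2) = 0" "sin (pi / 2) = 1" "cos pi = - 1" "sin pi = 0"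
      unfolding cos_add sin_add by simp_all
    ultimately show "cos (dihedral_angle 4 1) = 0" "sin (dihedral_angle 4 1) = 1"
      "cos (dihedral_angle 4 2) = - 1" "sin (dihedral_angle 4 2) = 0"
      "cos (dihedral_angle 4 3) = 0" "sin (dihedral_angle 4 3) = - 1"
      by (simp_all only:)
  qed (simp_all add: dihedral_angle_def)
  have s: "(\<Sum>k<4. F k) = F 0 + F 1 + F 2 + F 3" for F :: "nat \<Rightarrow> real"
    by (simp add: eval_nat_numeral)
  define p q p' q' where "p = u $ 1" and "q = u $ 2" and "p' = v $ 1" and "q' = v $ 2"
  define R M where "R = (\<lambda>k. (u \<bullet> v - (rot_matrix (dihedral_angle 4 k) *v u) \<bullet> v) / (2 * t))"
    and "M = (\<lambda>k. (u \<bullet> v - (mirror_matrix (dihedral_angle 4 k) *v u) \<bullet> v) / (2 * t))"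
  have "R 0 = 0" "R 1 = A + B - P + Q" "R 2 = 2 * A + 2 * B" "R 3 = A + B + P - Q"
    "M 0 = 2 * A" "M 1 = A + B + P + Q" "M 2 = 2 * B" "M 3 = A + B - P - Q"
    unfolding R_def M_def A_def B_def P_def Q_def rot_matrix_mult_vec mirror_matrix_mult_vec
      inner_real2 a vector_2 using assms(1)
    by (simp_all add: field_simps)
  moreover have "alternating_sum 4 t u v = (\<Sum>k<4. exp (- R (int k)) - exp (- M (int k)))"
    by (simp add: alternating_sum_def R_def M_def)
  ultimately have "alternating_sum 4 t u v =
      (1 - exp (- (2 * A))) + (exp (- (A + B - P + Q)) - exp (- (A + B + P + Q)))
      + (exp (- (2 * A + 2 * B)) - exp (- (2 * B))) + (exp (- (A + B + P - Q)) - exp (- (A + B - P - Q)))"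
    by (simp add: s)
  also have "\<dots> = (1 - exp (- (2 * A))) * (1 - exp (- (2 * B)))
      - exp (- (A + B - P - Q)) * ((1 - exp (- (2 * P))) * (1 - exp (- (2 * Q))))"
    by (simp add: algebra_simps flip: exp_add)
  finally show ?thesis .
qed

text \<open>
  For \<open>m = 3\<close> and \<open>m = 4\<close> the cone lies in the sector of this hypothesis, which bounds the
  distance to the edge above and below by the first coordinate.
\<close>

lemma norm_comparable_fst:
  fixes u :: "real ^ 2"
  assumes "\<bar>u $ 2\<bar> \<le> u $ 1"
  shows "u $ 1 \<le> norm u" and "norm u \<le> 2 * u $ 1"
proof -
  show "u $ 1 \<le> norm u" using component_le_norm_cart[of u 1] by simp
  have "norm u \<le> (\<Sum>i\<in>UNIV. \<bar>u $ i\<bar>)" by (rule norm_le_l1_cart)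
  thus "norm u \<le> 2 * u $ 1" using assms by (simp add: sum_2)
qed

lemma edge_factor_comparable:
  fixes u v :: "real ^ 2"
  assumes "\<bar>u $ 2\<bar> \<le> u $ 1" "\<bar>v $ 2\<bar> \<le> v $ 1" "t > 0"
  shows "min 1 (u $ 1 * v $ 1 / t) \<le> min 1 (norm u * norm v / t)"
    and "min 1 (norm u * norm v / t) \<le> 4 * min 1 (u $ 1 * v $ 1 / t)"
proof -
  note n = norm_comparable_fst[OF assms(1)] norm_comparable_fst[OF assms(2)]
  have nn: "0 \<le> u $ 1" "0 \<le> v $ 1" using assms by auto
  have "u $ 1 * v $ 1 \<le> norm u * norm v" using n nn by (intro mult_mono) auto
  thus "min 1 (u $ 1 * v $ 1 / t) \<le> min 1 (norm u * norm v / t)"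
    using assms(3) by (intro min.mono divide_right_mono) auto
  have "norm u * norm v \<le> (2 * u $ 1) * (2 * v $ 1)" using n nn by (intro mult_mono) auto
  hence "norm u * norm v / t \<le> (2 * u $ 1) * (2 * v $ 1) / t"
    using assms(3) by (intro divide_right_mono) auto
  also have "\<dots> = 4 * (u $ 1 * v $ 1 / t)" by simp
  finally have "min 1 (norm u * norm v / t) \<le> min 1 (4 * (u $ 1 * v $ 1 / t))" by simp
  also have "\<dots> \<le> 4 * min 1 (u $ 1 * v $ 1 / t)"
    using nn assms(3) by (intro min_one_scale_le) auto
  finally show "min 1 (norm u * norm v / t) \<le> 4 * min 1 (u $ 1 * v $ 1 / t)" .
qed

section \<open>The two-sided estimate\<close>

text \<open>
  The constant comes from \<open>m = 4\<close>: the two edge factors cost \<open>8\<close> each, the factor of the first side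
  costs \<open>2\<close>, and \<open>B2_alternating_sum_bounds\<close> costs \<open>80\<close>. The factors for \<open>m = 2\<close> and \<open>m = 3\<close>
  are \<open>4\<close> and \<open>48\<close>.
\<close>

lemma alternating_sum_comparable:
  fixes x y :: "(real ^ 'n) \<times> (real ^ 2)"
  assumes m: "m \<in> {2, 3, 4}" and x: "x \<in> wedge m" and y: "y \<in> wedge m" and t: "t > 0"
  defines "T \<equiv> (min 1 (norm (snd x) * norm (snd y) / t)) ^ (m - 2)
       * min 1 ((x \<bullet> wedge_normal1 m) * (y \<bullet> wedge_normal1 m) / t)
       * min 1 ((x \<bullet> wedge_normal2 m) * (y \<bullet> wedge_normal2 m) / t)"
  shows "alternating_sum m t (snd x) (snd y) \<le> T \<and> T \<le> 10240 * alternating_sum m t (snd x) (snd y)"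
proof -
  define u v where "u = snd x" and "v = snd y"
  let ?f = "alternating_sum m t u v"
  define \<sigma> where "\<sigma> = (\<lambda>z::real. 1 - exp (- z))"
  have \<sigma>: "\<sigma> z \<le> min 1 z" "min 1 z \<le> 2 * \<sigma> z" "\<sigma> z \<ge> 0" if "z > 0" for z
    using one_minus_exp_le_min[of z] one_minus_exp_ge_min[of z] that by (auto simp: \<sigma>_def)
  have d: "x \<bullet> wedge_normal1 m > 0" "x \<bullet> wedge_normal2 m > 0"
    "y \<bullet> wedge_normal1 m > 0" "y \<bullet> wedge_normal2 m > 0"
    using x y by (auto simp: wedge_def)
  consider "m = 2" | "m = 3" | "m = 4" using m by auto
  thus ?thesis
  proof cases
    case 1
    define D E where "D = u $ 2 * v $ 2 / t" and "E = u $ 1 * v $ 1 / t"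
    have f: "?f = \<sigma> D * \<sigma> E"
      unfolding 1 alternating_sum_2[OF t] by (simp add: \<sigma>_def D_def E_def)
    have pos: "D > 0" "E > 0"
      using d t unfolding 1 inner_wedge_normals u_def[symmetric] v_def[symmetric]
      by (simp_all add: D_def E_def)
    have T: "T = min 1 D * min 1 E"
      unfolding T_def 1 inner_wedge_normals u_def[symmetric] v_def[symmetric] by (simp add: D_def E_def)
    have "?f \<le> T" unfolding f T using pos by (intro mult_mono \<sigma>) auto
    moreover have "T \<le> (2 * \<sigma> D) * (2 * \<sigma> E)" unfolding T using pos \<sigma> by (intro mult_mono) auto
    moreover have "0 \<le> \<sigma> D * \<sigma> E" using pos \<sigma> by simp
    ultimately show ?thesis unfolding u_def[symmetric] v_def[symmetric] f by simp
  next
    case 2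
    define a1 a2 b1 b2 where "a1 = (u $ 1 + sqrt 3 * u $ 2) / 2" "a2 = (u $ 1 - sqrt 3 * u $ 2) / 2"
      "b1 = (v $ 1 + sqrt 3 * v $ 2) / 2" "b2 = (v $ 1 - sqrt 3 * v $ 2) / 2"
    note defs = this
    define A B P Q where "A = a1 * b1 / t" and "B = a2 * b2 / t" and "P = a1 * b2 / t" and "Q = a2 * b1 / t"
    have ab: "a1 > 0" "a2 > 0" "b1 > 0" "b2 > 0"
      using d unfolding 2 inner_wedge_normals u_def[symmetric] v_def[symmetric] defs[symmetric] by auto
    have pos: "A > 0" "B > 0" "P > 0" "Q > 0"
      using ab t by (auto simp: A_def B_def P_def Q_def)
    have "P * Q = A * B" by (simp add: A_def B_def P_def Q_def)
    note bounds = A2_alternating_sum_bounds[OF pos this]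
    have f: "?f = \<sigma> A * \<sigma> B - exp (- A - B) * (\<sigma> P * \<sigma> Q)"
      unfolding 2 alternating_sum_3[OF t] \<sigma>_def A_def B_def P_def Q_def defs by simp
    define S where "S = A + B + P + Q"
    have S: "S = u $ 1 * v $ 1 / t"
    proof -
      have "S = (a1 + a2) * (b1 + b2) / t"
        by (simp add: S_def A_def B_def P_def Q_def add_divide_distrib algebra_simps)
      moreover have "a1 + a2 = u $ 1" "b1 + b2 = v $ 1" by (simp_all add: defs field_simps)
      ultimately show ?thesis by simp
    qed
    have sector: "\<bar>w $ 2\<bar> \<le> w $ 1" if "(w $ 1 + sqrt 3 * w $ 2) / 2 > 0" "(w $ 1 - sqrt 3 * w $ 2) / 2 > 0"
      for w :: "real ^ 2"
    proof -
      have "1 * \<bar>w $ 2\<bar> \<le> sqrt 3 * \<bar>w $ 2\<bar>" by (intro mult_right_mono) auto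
      also have "sqrt 3 * \<bar>w $ 2\<bar> \<le> w $ 1" using that by (cases "w $ 2 \<ge> 0") auto
      finally show ?thesis by simp
    qed
    have "\<bar>u $ 2\<bar> \<le> u $ 1" "\<bar>v $ 2\<bar> \<le> v $ 1" using sector ab unfolding defs by blast+
    note e = edge_factor_comparable[OF this t, folded S]
    define E where "E = min 1 (norm u * norm v / t)"
    have T: "T = E * (min 1 A * min 1 B)"
      unfolding T_def 2 inner_wedge_normals u_def[symmetric] v_def[symmetric] defs[symmetric]
      by (simp add: A_def B_def E_def)
    have "?f \<le> (\<sigma> A * \<sigma> B) * min 1 S" using bounds(2) unfolding f S_def \<sigma>_def by simp
    also have "\<dots> \<le> (min 1 A * min 1 B) * E"
      unfolding E_def using pos e by (intro mult_mono \<sigma>) (auto simp: S_def)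
    finally have "?f \<le> T" by (simp add: T mult_ac)
    moreover have "T \<le> (4 * min 1 S) * ((2 * \<sigma> A) * (2 * \<sigma> B))"
      unfolding T E_def using pos e \<sigma> t by (intro mult_mono) (auto simp: S_def)
    hence "T \<le> 48 * (\<sigma> A * \<sigma> B * (min 1 S / 3))" by (simp add: mult_ac)
    moreover have "\<sigma> A * \<sigma> B * (min 1 S / 3) \<le> ?f" using bounds(1) unfolding f S_def \<sigma>_def by simp
    moreover have "0 \<le> \<sigma> A * \<sigma> B * (min 1 S / 3)" using pos \<sigma> by (simp add: S_def)
    ultimately show ?thesis unfolding u_def[symmetric] v_def[symmetric] by linarith
  next
    case 3
    define A B P Q where "A = u $ 1 * v $ 1 / (2 * t)" and "B = u $ 2 * v $ 2 / (2 * t)"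
      and "P = u $ 1 * v $ 2 / (2 * t)" and "Q = u $ 2 * v $ 1 / (2 * t)"
    define R where "R = A + B - P - Q"
    have c: "u $ 2 > 0" "u $ 1 - u $ 2 > 0" "v $ 2 > 0" "v $ 1 - v $ 2 > 0"
      using d unfolding 3 inner_wedge_normals u_def[symmetric] v_def[symmetric]
      by (auto simp: zero_less_divide_iff)
    hence pos: "B > 0" "A > 0" using t by (auto simp: A_def B_def)
    have ord: "B \<le> P" "P \<le> A" "B \<le> Q" "Q \<le> A"
      unfolding A_def B_def P_def Q_def using c t by (intro divide_right_mono mult_mono; simp)+
    have R: "R = (u $ 1 - u $ 2) * (v $ 1 - v $ 2) / (2 * t)"
      by (simp add: R_def A_def B_def P_def Q_def add_divide_distrib diff_divide_distrib algebra_simps)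
    hence R0: "R > 0" using c t by simp
    have "A * B = P * Q" by (simp add: A_def B_def P_def Q_def)
    note bounds = B2_alternating_sum_bounds[OF pos(1) ord this, folded R_def]
    have f: "?f = \<sigma> (2 * A) * \<sigma> (2 * B) - exp (- R) * (\<sigma> (2 * P) * \<sigma> (2 * Q))"
      unfolding 3 alternating_sum_4[OF t] \<sigma>_def A_def B_def P_def Q_def R_def by simp
    have A2: "2 * A = u $ 1 * v $ 1 / t" by (simp add: A_def)
    have "\<bar>u $ 2\<bar> \<le> u $ 1" "\<bar>v $ 2\<bar> \<le> v $ 1" using c by auto
    note e = edge_factor_comparable[OF this t, folded A2]
    define E where "E = min 1 (norm u * norm v / t)"
    have T: "T = (E * E) * (min 1 (2 * B) * min 1 R)"
    proof -
      have "(u $ 1 - u $ 2) / sqrt 2 * ((v $ 1 - v $ 2) / sqrt 2) / t = R"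
        by (simp add: R)
      thus ?thesis
        unfolding T_def 3 inner_wedge_normals u_def[symmetric] v_def[symmetric]
        by (simp add: B_def E_def power2_eq_square)
    qed
    have E: "min 1 (2 * A) \<le> E" "E \<le> 4 * min 1 (2 * A)" "0 \<le> E" using e t by (auto simp: E_def)
    have EA: "min 1 A \<le> E" using E(1) pos by (auto simp: min_def split: if_splits)
    have EA': "E \<le> 8 * min 1 A" using E(2) min_one_scale_le[of 2 A] pos by linarith
    have E\<sigma>: "\<sigma> (2 * A) \<le> E" using E(1) \<sigma>(1)[of "2 * A"] pos by linarith
    have E\<sigma>': "E \<le> 8 * \<sigma> (2 * A)" using E(2) \<sigma>(2)[of "2 * A"] pos by linarith
    have "?f \<le> (\<sigma> (2 * A) * \<sigma> (2 * B)) * (min 1 A * min 1 R)"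
      using bounds(2) unfolding f \<sigma>_def by simp
    also have "\<dots> \<le> (E * min 1 (2 * B)) * (E * min 1 R)"
      using pos R0 E \<sigma> E\<sigma> EA by (intro mult_mono) auto
    finally have "?f \<le> T" by (simp add: T mult_ac)
    moreover have "T \<le> ((8 * \<sigma> (2 * A)) * (8 * min 1 A)) * ((2 * \<sigma> (2 * B)) * min 1 R)"
      unfolding T using pos R0 E \<sigma> E\<sigma>' EA' by (intro mult_mono) auto
    hence "T \<le> 10240 * (\<sigma> (2 * A) * \<sigma> (2 * B) * (min 1 A * min 1 R / 80))" by (simp add: mult_ac)
    moreover have "\<sigma> (2 * A) * \<sigma> (2 * B) * (min 1 A * min 1 R / 80) \<le> ?f"
      using bounds(1) unfolding f \<sigma>_def by simp
    ultimately show ?thesis unfolding u_def[symmetric] v_def[symmetric] by linarith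
  qed
qed

theorem mainTheorem6:
  fixes m :: nat
  assumes "m \<in> {2, 3, 4}"
  shows "uniformly_comparable_on
    ((wedge m :: ((real ^ 'n) \<times> (real ^ 2)) set) \<times> wedge m \<times> {0<..})
    (\<lambda>(x, y, t). wedge_heat_kernel m t x y)
    (\<lambda>(x, y, t).
       (min 1 (infdist x (wedge_edge m) * infdist y (wedge_edge m) / t)) ^ (m - 2)
       * min 1 (infdist x (wedge_side1 m) * infdist y (wedge_side1 m) / t)
       * min 1 (infdist x (wedge_side2 m) * infdist y (wedge_side2 m) / t)
       * gauss_weierstrass t (x - y))"
  unfolding uniformly_comparable_on_def
proof (intro exI[of _ "10240::real"] conjI ballI)
  fix z :: "((real ^ 'n) \<times> (real ^ 2)) \<times> ((real ^ 'n) \<times> (real ^ 2)) \<times> real"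
  assume "z \<in> wedge m \<times> wedge m \<times> {0<..}"
  then obtain x y t where z: "z = (x, y, t)" and x: "x \<in> wedge m" and y: "y \<in> wedge m" and t: "t > 0"
    by auto
  define T where "T = (min 1 (norm (snd x) * norm (snd y) / t)) ^ (m - 2)
       * min 1 ((x \<bullet> wedge_normal1 m) * (y \<bullet> wedge_normal1 m) / t)
       * min 1 ((x \<bullet> wedge_normal2 m) * (y \<bullet> wedge_normal2 m) / t)"
  define f where "f = alternating_sum m t (snd x) (snd y)"
  define g where "g = gauss_weierstrass t (x - y)"
  have "m > 0" using assms by auto
  note kernel = wedge_heat_kernel_eq[OF this t, of x y, folded f_def g_def]
  note dist = infdist_wedge_edge[OF assms x] infdist_wedge_edge[OF assms y]
    infdist_wedge_sides[OF assms x] infdist_wedge_sides[OF assms y]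
  have fT: "f \<le> T" "T \<le> 10240 * f"
    using alternating_sum_comparable[OF assms x y t] unfolding T_def f_def by auto
  have g: "g \<ge> 0" by (simp add: g_def gauss_weierstrass_def)
  have "inverse 10240 * T \<le> f" "f \<le> 10240 * T" using fT by simp_all
  hence "inverse 10240 * T * g \<le> f * g" "f * g \<le> 10240 * T * g"
    using mult_right_mono[OF _ g] by blast+
  thus "inverse 10240 * (case z of (x, y, t) \<Rightarrow>
       (min 1 (infdist x (wedge_edge m) * infdist y (wedge_edge m) / t)) ^ (m - 2)
       * min 1 (infdist x (wedge_side1 m) * infdist y (wedge_side1 m) / t)
       * min 1 (infdist x (wedge_side2 m) * infdist y (wedge_side2 m) / t)
       * gauss_weierstrass t (x - y)) \<le> (case z of (x, y, t) \<Rightarrow> wedge_heat_kernel m t x y)"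
    and "(case z of (x, y, t) \<Rightarrow> wedge_heat_kernel m t x y) \<le> 10240 * (case z of (x, y, t) \<Rightarrow>
       (min 1 (infdist x (wedge_edge m) * infdist y (wedge_edge m) / t)) ^ (m - 2)
       * min 1 (infdist x (wedge_side1 m) * infdist y (wedge_side1 m) / t)
       * min 1 (infdist x (wedge_side2 m) * infdist y (wedge_side2 m) / t)
       * gauss_weierstrass t (x - y))"
    unfolding z prod.case dist kernel T_def[symmetric] g_def[symmetric] by (simp_all only: mult.assoc)
qed simp

end
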